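(* Let $0<q<1$, $n\ge1$, $L\ge1$. For $n$-species configurations $\boldsymbol\xi=(\xi_i^x)$ and $\boldsymbol\eta=(\eta_i^x)$, $1\le x\le L$, $0\le i\le n-1$, with $\xi_i^x,\eta_i^x\in\mathbb Z_{\ge0}$, set $$h(\boldsymbol\xi,\boldsymbol\eta)=\sum_{x=1}^L\sum_{i=0}^{n-1}\Big(-\xi_i^xN^+_{x+1}(\boldsymbol\eta_{[0,n-2-i]})+\eta_i^xN^+_x(\boldsymbol\xi_{[0,n-2-i]})\Big).$$ Then the two expressions $$D(\boldsymbol\xi,\boldsymbol\eta)=q^{h(\boldsymbol\xi,\boldsymbol\eta)}\prod_{i=0}^{n-1}\prod_{x=1}^L{}_1\phi_0\Big(q^{-2\xi_i^x};q^2,q^{-2(N^-_{x-1}(\boldsymbol\xi_i)+N^+_{x+1}(\boldsymbol\eta_{n-1-i}))+1}\Big)=q^{h(\boldsymbol\xi,\boldsymbol\eta)}\prod_{i=0}^{n-1}\prod_{x=1}^L\Big(q^{-2(N^-_{x}(\boldsymbol\xi_i)+N^+_{x+1}(\boldsymbol\eta_{n-1-i}))+1};q^2\Big)_{\xi_i^x}$$ are equal, and $D$ is a space-reversed duality function for the $n$-species $q$-TAZRP: if $\boldsymbol\xi(t)$ is the $n$-species $q$-TAZRP with total asymmetry to the right and $\boldsymbol\eta(t)$ is the $n$-species $q$-TAZRP with total asymmetry to the left, then $\mathbb E_{\boldsymbol\xi}[D(\boldsymbol\xi(t),\boldsymbol\eta)]=\mathbb E_{\boldsymbol\eta}[D(\boldsymbol\xi,\boldsymbol\eta(t))]$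 for all $t\ge0$ and all $\boldsymbol\xi,\boldsymbol\eta$.
   Context: Notation: $\boldsymbol\xi_i=(\xi_i^1,\dots,\xi_i^L)$; $\boldsymbol\xi_{[a,b]}=\sum_{j=a}^b\boldsymbol\xi_j$ and $\xi^x_{[a,b]}=\sum_{j=a}^b\xi^x_j$ (zero if $b<a$); for a vector $\boldsymbol v$, $N_x^-(\boldsymbol v)=\sum_{1\le y\le x}v^y$ and $N_x^+(\boldsymbol v)=\sum_{x\le y\le L}v^y$. $(a;q)_k=\prod_{j=0}^{k-1}(1-aq^j)$ and ${}_1\phi_0(q^{-m};q,z)=\sum_{k=0}^m\frac{(q^{-m};q)_k}{(q;q)_k}z^k$ for $m\in\mathbb Z_{\ge0}$ (used with $q^2$ in place of $q$). The $n$-species $q$-TAZRP with total asymmetry to the right on $\{1,\dots,L\}$ (closed boundary) is the continuous-time Markov chain on configurations with $\xi_i^x\in\mathbb Z_{\ge0}$ in which, for every $1\le x\le L-1$ and every species $0\le k\le n-1$, one species $k$ particle jumps from $x$ to $x+1$ at rate $$q^{2\xi^x_{[0,k-1]}}\,\frac{1-q^{2\xi_k^x}}{1-q^2}.$$ The process with total asymmetry to the left is its mirror image: for $2\le x\le L$ a species $k$ particle jumps from $x$ to $x-1$ at the same rate (with $\boldsymbol\xi$ replaced by its own configuration). *)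

theory Defs
  imports "HOL-Probability.Probability"
begin

section \<open>Continuous-time Markov chains with given jump rates\<close>

text \<open>
  \<open>Q\<close> is the full Q-matrix on the countable state space \<open>S\<close>, including the diagonal
  entries \<open>Q x x = - (total exit rate from x)\<close>. A transition function has \<open>Q\<close> as its matrix of
  rates if it is a semigroup of probability kernels on \<open>S\<close> with (right) derivative \<open>Q\<close> at time 0.
\<close>

definition transition_function ::
    "'s set \<Rightarrow> ('s \<Rightarrow> 's \<Rightarrow> real) \<Rightarrow> (real \<Rightarrow> 's \<Rightarrow> 's pmf) \<Rightarrow> bool" where
  "transition_function S Q P \<longleftrightarrow>
     (\<forall>x\<in>S. \<forall>t\<ge>0. set_pmf (P t x) \<subseteq> S) \<and>
     (\<forall>x\<in>S. P 0 x = return_pmf x) \<and>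
     (\<forall>x\<in>S. \<forall>s\<ge>0. \<forall>t\<ge>0. P (s + t) x = bind_pmf (P s x) (P t)) \<and>
     (\<forall>x\<in>S. \<forall>y\<in>S. ((\<lambda>t. pmf (P t x) y) has_real_derivative Q x y) (at 0 within {0..}))"

text \<open>
  The process \<open>X\<close> on the probability space \<open>M\<close> is a Markov chain with Q-matrix \<open>Q\<close> started
  from \<open>x0\<close>. Since \<open>S\<close> is countable, the Markov property with respect to the past up to time
  \<open>s\<close> is expressed through the elementary events fixing the values of \<open>X\<close> at the times in a
  finite set \<open>J\<close>. Paths are almost surely right-continuous for the discrete topology on \<open>S\<close>.
\<close>

definition markov_chain ::
    "'s set \<Rightarrow> ('s \<Rightarrow> 's \<Rightarrow> real) \<Rightarrow> 's \<Rightarrow> 'w measure \<Rightarrow> (real \<Rightarrow> 'w \<Rightarrow> 's) \<Rightarrow> bool" where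
  "markov_chain S Q x0 M X \<longleftrightarrow>
     prob_space M \<and>
     (\<forall>t\<ge>0. X t \<in> M \<rightarrow>\<^sub>M count_space S) \<and>
     (AE \<omega> in M. X 0 \<omega> = x0) \<and>
     (AE \<omega> in M. \<forall>t\<ge>0. \<forall>\<^sub>F s in at_right t. X s \<omega> = X t \<omega>) \<and>
     (\<exists>P. transition_function S Q P \<and>
        (\<forall>s\<ge>0. \<forall>t\<ge>0. \<forall>J z. \<forall>x\<in>S. \<forall>y\<in>S. finite J \<and> J \<subseteq> {0..s} \<longrightarrow>
           \<P>(\<omega> in M. (\<forall>u\<in>J. X u \<omega> = z u) \<and> X s \<omega> = x \<and> X (s + t) \<omega> = y) =
           \<P>(\<omega> in M. (\<forall>u\<in>J. X u \<omega> = z u) \<and> X s \<omega> = x) * pmf (P t x) y))"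


section \<open>The multi-species q-TAZRP\<close>

text \<open>
  \<open>\<xi> i x\<close> is the number of particles of species \<open>i\<close> at site \<open>x\<close>; it is set to 0 outside the
  range \<open>i \<in> {0..n-1}\<close>, \<open>x \<in> {1..L}\<close>, so that distinct functions are distinct configurations.
\<close>

type_synonym config = "nat \<Rightarrow> nat \<Rightarrow> nat"

definition configs :: "nat \<Rightarrow> nat \<Rightarrow> config set" where
  "configs n L = {\<xi>. \<forall>i x. \<not> (i < n \<and> 1 \<le> x \<and> x \<le> L) \<longrightarrow> \<xi> i x = 0}"

text \<open>
  Species sums over an initial interval: \<open>below \<xi> k\<close> is \<open>\<xi>\<^bsub>[0,k-1]\<^esub>\<close>, which is zero for \<open>k = 0\<close>.
\<close>

definition below :: "config \<Rightarrow> nat \<Rightarrow> nat \<Rightarrow> nat" where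
  "below \<xi> k x = (\<Sum>j<k. \<xi> j x)"

text \<open>
  One particle of species \<open>k\<close> moves from \<open>x\<close> to \<open>y \<noteq> x\<close>. When there is no such particle, the
  truncated subtraction gives a meaningless result, but then \<open>jump_rate\<close> is 0.
\<close>

definition move :: "config \<Rightarrow> nat \<Rightarrow> nat \<Rightarrow> nat \<Rightarrow> config" where
  "move \<xi> k x y = \<xi>(k := (\<xi> k)(x := \<xi> k x - 1, y := \<xi> k y + 1))"

definition jump_rate :: "real \<Rightarrow> config \<Rightarrow> nat \<Rightarrow> nat \<Rightarrow> real" where
  "jump_rate q \<xi> k x = q ^ (2 * below \<xi> k x) * ((1 - q ^ (2 * \<xi> k x)) / (1 - q\<^sup>2))"

text \<open>
  The Q-matrices: each possible jump contributes its rate to the entry of the target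
  configuration and subtracts it from the diagonal.
\<close>

definition tazrp_right :: "real \<Rightarrow> nat \<Rightarrow> nat \<Rightarrow> config \<Rightarrow> config \<Rightarrow> real" where
  "tazrp_right q n L \<xi> \<xi>' =
     (\<Sum>x\<in>{1..<L}. \<Sum>k<n. jump_rate q \<xi> k x * (of_bool (\<xi>' = move \<xi> k x (x + 1)) - of_bool (\<xi>' = \<xi>)))"

definition tazrp_left :: "real \<Rightarrow> nat \<Rightarrow> nat \<Rightarrow> config \<Rightarrow> config \<Rightarrow> real" where
  "tazrp_left q n L \<eta> \<eta>' =
     (\<Sum>x\<in>{2..L}. \<Sum>k<n. jump_rate q \<eta> k x * (of_bool (\<eta>' = move \<eta> k x (x - 1)) - of_bool (\<eta>' = \<eta>)))"


section \<open>The duality function\<close>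

definition N_minus :: "nat \<Rightarrow> (nat \<Rightarrow> nat) \<Rightarrow> nat" where
  "N_minus x v = (\<Sum>y=1..x. v y)"

definition N_plus :: "nat \<Rightarrow> nat \<Rightarrow> (nat \<Rightarrow> nat) \<Rightarrow> nat" where
  "N_plus L x v = (\<Sum>y=x..L. v y)"

definition q_pochhammer :: "real \<Rightarrow> real \<Rightarrow> nat \<Rightarrow> real" where
  "q_pochhammer a q k = (\<Prod>j<k. 1 - a * q ^ j)"

text \<open>\<open>phi_1_0 m q z\<close> is the terminating series \<open>\<^sub>1\<phi>\<^sub>0(q\<^bsup>-m\<^esup>; q, z)\<close>.\<close>

definition phi_1_0 :: "nat \<Rightarrow> real \<Rightarrow> real \<Rightarrow> real" where
  "phi_1_0 m q z = (\<Sum>k\<le>m. q_pochhammer (q powi (- int m)) q k / q_pochhammer q q k * z ^ k)"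

text \<open>For \<open>i < n\<close>, the vector \<open>\<eta>\<^bsub>[0,n-2-i]\<^esub>\<close> is \<open>below \<eta> (n - 1 - i)\<close>.\<close>

definition h_exponent :: "nat \<Rightarrow> nat \<Rightarrow> config \<Rightarrow> config \<Rightarrow> int" where
  "h_exponent n L \<xi> \<eta> =
     (\<Sum>x=1..L. \<Sum>i<n. - (int (\<xi> i x) * int (N_plus L (x + 1) (below \<eta> (n - 1 - i))))
                     + int (\<eta> i x) * int (N_plus L x (below \<xi> (n - 1 - i))))"

definition D_phi :: "real \<Rightarrow> nat \<Rightarrow> nat \<Rightarrow> config \<Rightarrow> config \<Rightarrow> real" where
  "D_phi q n L \<xi> \<eta> = q powi h_exponent n L \<xi> \<eta> *
     (\<Prod>i<n. \<Prod>x=1..L. phi_1_0 (\<xi> i x) (q\<^sup>2)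
        (q powi (- 2 * int (N_minus (x - 1) (\<xi> i) + N_plus L (x + 1) (\<eta> (n - 1 - i))) + 1)))"

definition D_poch :: "real \<Rightarrow> nat \<Rightarrow> nat \<Rightarrow> config \<Rightarrow> config \<Rightarrow> real" where
  "D_poch q n L \<xi> \<eta> = q powi h_exponent n L \<xi> \<eta> *
     (\<Prod>i<n. \<Prod>x=1..L. q_pochhammer
        (q powi (- 2 * int (N_minus x (\<xi> i) + N_plus L (x + 1) (\<eta> (n - 1 - i))) + 1)) (q\<^sup>2) (\<xi> i x))"

end

theory Submission
  imports Defs
begin

text \<open>
  Write \<open>p = q\<^sup>2\<close> and fix a bond \<open>(x, x + 1)\<close>. Pair species \<open>k\<close> of \<open>\<xi>\<close> with species
  \<open>l = n - 1 - k\<close> of \<open>\<eta>\<close>, put \<open>u = p ^ \<xi> k x\<close>, \<open>v = p ^ \<eta> l (x + 1)\<close>, and let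
  \<open>X\<close>, \<open>Y\<close> be \<open>p\<close> to the number of particles of \<open>\<xi>\<close> of species below \<open>k\<close> at \<open>x\<close>, respectively
  of \<open>\<eta>\<close> of species below \<open>l\<close> at \<open>x + 1\<close>. By telescoping of the q-Pochhammer factors there is
  \<open>a \<noteq> 1\<close> such that a jump of \<open>\<xi>\<close> across the bond multiplies \<open>D\<close> by \<open>Y (1 - a v) / (1 - a)\<close>
  and the opposite jump of \<open>\<eta>\<close> multiplies it by \<open>X (1 - a u) / (1 - a)\<close>. The difference of the
  two weighted contributions is free of \<open>a\<close> and telescopes in \<open>k\<close>, so the generators are dual
  bond by bond.

  Particle numbers are conserved, which confines both chains to finite closed sets. There, both
  the escape probability from the closed set and the defect in the duality of the semigroups are
  subadditive in time with derivative 0 at time 0, hence vanish.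
\<close>

subsection \<open>Transition functions on finite closed sets\<close>

text \<open>The zero derivative gives \<open>\<bar>e h k\<bar> \<le> c * h\<close> for small
  \<open>h\<close>, uniformly over the finite \<open>K\<close>; subadditivity carries the bound
  along multiples of \<open>h\<close>, hence to every \<open>t\<close>, and \<open>c > 0\<close> is
  arbitrary. \<open>subadd\<close> expresses subadditivity of the maximum over \<open>K\<close>
  through upper bounds \<open>a\<close> and \<open>b\<close>.\<close>

lemma subadditive_zero_derivative_eq_0:
  fixes e :: "real \<Rightarrow> 'k \<Rightarrow> real"
  assumes K: "finite K"
    and zero: "\<And>k. k \<in> K \<Longrightarrow> e 0 k = 0"
    and deriv: "\<And>k. k \<in> K \<Longrightarrow> ((\<lambda>t. e t k) has_real_derivative 0) (at 0 within {0..})"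
    and subadd: "\<And>s t a b. \<lbrakk>0 \<le> s; 0 \<le> t; \<forall>k\<in>K. \<bar>e s k\<bar> \<le> a; \<forall>k\<in>K. \<bar>e t k\<bar> \<le> b\<rbrakk>
      \<Longrightarrow> \<forall>k\<in>K. \<bar>e (s + t) k\<bar> \<le> a + b"
    and t: "0 \<le> t" and k: "k \<in> K"
  shows "e t k = 0"
proof -
  have bound: "\<bar>e t k\<bar> \<le> c * t" if c: "c > 0" for c
  proof -
    have "\<forall>k\<in>K. \<forall>\<^sub>F h in at 0 within {0..}. \<bar>e h k\<bar> \<le> c * h"
    proof
      fix j assume j: "j \<in> K"
      have "((\<lambda>h. e h j / h) \<longlongrightarrow> 0) (at 0 within {0..})"
        using deriv[OF j] zero[OF j] by (simp add: has_field_derivative_iff)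
      from tendstoD[OF this c] have "\<forall>\<^sub>F h in at 0 within {0..}. \<bar>e h j / h\<bar> < c"
        by simp
      moreover have "\<forall>\<^sub>F h in at 0 within {0..}. 0 < (h::real)"
        by (auto simp: eventually_at_filter)
      ultimately show "\<forall>\<^sub>F h in at 0 within {0..}. \<bar>e h j\<bar> \<le> c * h"
        by eventually_elim (auto simp: abs_divide divide_less_eq mult.commute)
    qed
    then have "\<forall>\<^sub>F h in at 0 within {0..}. \<forall>j\<in>K. \<bar>e h j\<bar> \<le> c * h"
      using K by (simp add: eventually_ball_finite)
    then obtain d where d: "d > 0"
      and small: "\<And>h j. 0 < h \<Longrightarrow> h < d \<Longrightarrow> j \<in> K \<Longrightarrow> \<bar>e h j\<bar> \<le> c * h"
      unfolding eventually_at by (auto simp: dist_real_def)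
    have multiples: "\<forall>j\<in>K. \<bar>e (real m * h) j\<bar> \<le> c * (real m * h)" if "0 < h" "h < d" for m h
    proof (induction m)
      case 0
      then show ?case by (simp add: zero)
    next
      case (Suc m)
      have "\<forall>j\<in>K. \<bar>e (h + real m * h) j\<bar> \<le> c * h + c * (real m * h)"
        using that Suc small by (intro subadd) auto
      then show ?case by (simp add: algebra_simps)
    qed
    obtain m :: nat where m: "t / d < real m"
      using reals_Archimedean2 by blast
    then have m0: "0 < real m"
      using t d by (intro le_less_trans[OF _ m]) simp
    show ?thesis
    proof (cases "t = 0")
      case True
      then show ?thesis using zero[OF k] by simp
    next
      case False
      with t m m0 d have "0 < t / real m" "t / real m < d"
        by (auto simp: field_simps)
      from multiples[OF this, of m] k m0 show ?thesis by simp
    qed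
  qed
  show ?thesis
  proof (rule ccontr)
    assume "e t k \<noteq> 0"
    \<comment> \<open>With this quotient as \<open>c\<close>, the bound becomes
      \<open>\<bar>e t k\<bar> \<le> \<bar>e t k\<bar> * t / (t + 1)\<close>, which is impossible
      for a nonzero value.\<close>
    with t have "\<bar>e t k\<bar> / (t + 1) > 0" by simp
    from bound[OF this] t \<open>e t k \<noteq> 0\<close> show False by (simp add: field_simps)
  qed
qed

text \<open>Discards the nonnegative contribution from outside \<open>C\<close>. It bounds the
  Chapman-Kolmogorov equation from below before the chain is known to stay in
  \<open>C\<close>.\<close>

lemma sum_pmf_mult_le_expectation:
  assumes C: "finite C" and g: "\<And>z. 0 \<le> g z" "\<And>z. g z \<le> (1::real)"
  shows "(\<Sum>z\<in>C. pmf p z * g z) \<le> measure_pmf.expectation p g"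
proof -
  have "(\<Sum>z\<in>C. pmf p z * g z) = measure_pmf.expectation p (\<lambda>z. g z * indicator C z)"
    using C by (subst integral_measure_pmf_real[where A = C])
      (auto simp: mult.commute indicator_def split: if_splits)
  also have "\<dots> \<le> measure_pmf.expectation p g"
    using g by (intro integral_mono measure_pmf.integrable_const_bound[where B = 1])
      (auto simp: indicator_def)
  finally show ?thesis .
qed

lemma abs_sum_pmf_mult_le:
  fixes c :: real
  assumes A: "finite A" "set_pmf p \<subseteq> A" and f: "\<And>z. z \<in> A \<Longrightarrow> \<bar>f z\<bar> \<le> c"
  shows "\<bar>\<Sum>z\<in>A. pmf p z * f z\<bar> \<le> c"
proof -
  have "\<bar>\<Sum>z\<in>A. pmf p z * f z\<bar> \<le> (\<Sum>z\<in>A. \<bar>pmf p z * f z\<bar>)"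
    by (rule sum_abs)
  also have "\<dots> \<le> (\<Sum>z\<in>A. pmf p z * c)"
    using f by (intro sum_mono) (auto simp: abs_mult mult_left_mono)
  also have "\<dots> = c"
    using A by (simp add: sum_distrib_right[symmetric] sum_pmf_eq_1)
  finally show ?thesis .
qed

lemma expectation_bind_pmf_finite:
  fixes f :: "'s \<Rightarrow> real"
  assumes C: "finite C" and p: "set_pmf p \<subseteq> C" and r: "\<And>z. z \<in> C \<Longrightarrow> set_pmf (r z) \<subseteq> C"
  shows "measure_pmf.expectation (bind_pmf p r) f
    = (\<Sum>z\<in>C. pmf p z * measure_pmf.expectation (r z) f)"
proof -
  have fin: "measure_pmf.expectation p' f' = (\<Sum>a\<in>C. f' a * pmf p' a)"
    if "set_pmf p' \<subseteq> C" for p' and f' :: "'s \<Rightarrow> real"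
    using that C by (intro integral_measure_pmf_real) auto
  have "measure_pmf.expectation (bind_pmf p r) f = (\<Sum>a\<in>C. f a * (\<Sum>z\<in>C. pmf (r z) a * pmf p z))"
    using p r by (subst fin) (auto simp: pmf_bind fin[OF p])
  also have "\<dots> = (\<Sum>z\<in>C. pmf p z * (\<Sum>a\<in>C. f a * pmf (r z) a))"
    unfolding sum_distrib_left by (subst sum.swap) (simp add: mult_ac)
  also have "\<dots> = (\<Sum>z\<in>C. pmf p z * measure_pmf.expectation (r z) f)"
    using r by (simp add: fin)
  finally show ?thesis .
qed

text \<open>Let \<open>e t x\<close> be the probability of being outside \<open>C\<close> at time
  \<open>t\<close>. Its derivative at 0 is minus a row sum over \<open>C\<close>, hence 0. It is
  subadditive because being in \<open>C\<close> at time \<open>s\<close> and again a time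
  \<open>t\<close> later is one way of being in \<open>C\<close> at time
  \<open>s + t\<close>.\<close>

lemma transition_function_closed:
  assumes tf: "transition_function S Q P"
    and C: "finite C" "C \<subseteq> S"
    and closed: "\<And>x. x \<in> C \<Longrightarrow> (\<Sum>y\<in>C. Q x y) = 0"
    and t: "0 \<le> t" and x: "x \<in> C"
  shows "set_pmf (P t x) \<subseteq> C"
proof -
  define e where "e t x = 1 - (\<Sum>y\<in>C. pmf (P t x) y)" for t x
  have mass: "(\<Sum>y\<in>C. pmf p y) \<le> 1" for p
    using measure_pmf.prob_le_1[of p C] C(1) by (simp add: measure_measure_pmf_finite)
  then have e_nonneg: "0 \<le> e t x" for t x
    by (simp add: e_def)
  have deriv: "((\<lambda>t. pmf (P t x) y) has_real_derivative Q x y) (at 0 within {0..})"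
    if "x \<in> C" "y \<in> C" for x y
    using tf C(2) that unfolding transition_function_def by blast
  have start: "e 0 x = 0" if "x \<in> C" for x
  proof -
    have "P 0 x = return_pmf x"
      using tf C(2) that unfolding transition_function_def by auto
    then have "(\<Sum>y\<in>C. pmf (P 0 x) y) = 1"
      using that C(1) by (intro sum_pmf_eq_1) auto
    then show ?thesis by (simp add: e_def)
  qed
  have "e t x = 0"
  proof (rule subadditive_zero_derivative_eq_0[of C e])
    show "finite C" "0 \<le> t" "x \<in> C" by fact+
  next
    fix x assume "x \<in> C"
    then show "e 0 x = 0" by (rule start)
  next
    fix x assume x: "x \<in> C"
    have "((\<lambda>t. e t x) has_real_derivative 0 - (\<Sum>y\<in>C. Q x y)) (at 0 within {0..})"
      unfolding e_def using x by (intro DERIV_diff DERIV_sum DERIV_const deriv)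
    then show "((\<lambda>t. e t x) has_real_derivative 0) (at 0 within {0..})"
      using closed[OF x] by simp
  next
    fix s t a b :: real
    assume st: "0 \<le> s" "0 \<le> t" and a: "\<forall>k\<in>C. \<bar>e s k\<bar> \<le> a" and b: "\<forall>k\<in>C. \<bar>e t k\<bar> \<le> b"
    show "\<forall>x\<in>C. \<bar>e (s + t) x\<bar> \<le> a + b"
    proof
      fix x assume x: "x \<in> C"
      then have b0: "0 \<le> b" using b by fastforce
      have bind: "P (s + t) x = bind_pmf (P s x) (P t)"
        using tf x st C(2) unfolding transition_function_def by auto
      have "(\<Sum>z\<in>C. pmf (P s x) z * (1 - e t z))
          = (\<Sum>z\<in>C. \<Sum>y\<in>C. pmf (P s x) z * pmf (P t z) y)"
        by (simp add: e_def sum_distrib_left)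
      also have "\<dots> = (\<Sum>y\<in>C. \<Sum>z\<in>C. pmf (P s x) z * pmf (P t z) y)"
        by (rule sum.swap)
      also have "\<dots> \<le> (\<Sum>y\<in>C. pmf (P (s + t) x) y)"
        unfolding bind pmf_bind
        by (intro sum_mono sum_pmf_mult_le_expectation C) (auto simp: pmf_le_1)
      also have "\<dots> = 1 - e (s + t) x"
        by (simp add: e_def)
      finally have "e (s + t) x \<le> 1 - (\<Sum>z\<in>C. pmf (P s x) z * (1 - e t z))"
        by simp
      also have "\<dots> = e s x + (\<Sum>z\<in>C. pmf (P s x) z * e t z)"
        by (simp add: e_def[of s] right_diff_distrib sum_subtractf)
      also have "(\<Sum>z\<in>C. pmf (P s x) z * e t z) \<le> (\<Sum>z\<in>C. pmf (P s x) z * b)"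
        using b by (intro sum_mono mult_left_mono) fastforce+
      also have "\<dots> \<le> b"
        using mult_right_mono[OF mass b0, of "P s x"] by (simp add: sum_distrib_right)
      finally show "\<bar>e (s + t) x\<bar> \<le> a + b"
        using a x e_nonneg[of "s + t" x] by fastforce
    qed
  qed
  then have "measure_pmf.prob (P t x) C = 1"
    using C(1) by (simp add: e_def measure_measure_pmf_finite)
  then show ?thesis
    by (auto simp: measure_pmf.prob_eq_1 AE_measure_pmf_iff)
qed

text \<open>The defect \<open>e\<close> has derivative 0 at time 0 by the duality of the generators,
  and inserting the mixed average of \<open>D\<close> under \<open>P s x\<close> and
  \<open>R t y\<close> shows that it is subadditive.\<close>

lemma generator_duality_imp_semigroup_duality:
  assumes tfP: "transition_function S Q P" and tfR: "transition_function S' Q' R"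
    and C: "finite C" "C \<subseteq> S" "\<And>x. x \<in> C \<Longrightarrow> (\<Sum>z\<in>C. Q x z) = 0"
    and C': "finite C'" "C' \<subseteq> S'" "\<And>y. y \<in> C' \<Longrightarrow> (\<Sum>z\<in>C'. Q' y z) = 0"
    and duality: "\<And>x y. x \<in> C \<Longrightarrow> y \<in> C' \<Longrightarrow>
      (\<Sum>z\<in>C. Q x z * D z y) = (\<Sum>z\<in>C'. Q' y z * D x z)"
    and t: "0 \<le> t" and x: "x \<in> C" and y: "y \<in> C'"
  shows "measure_pmf.expectation (P t x) (\<lambda>z. D z y) = measure_pmf.expectation (R t y) (D x)"
proof -
  have closed: "set_pmf (P t x) \<subseteq> C" if "0 \<le> t" "x \<in> C" for t x
    using transition_function_closed[OF tfP C] that by blast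
  have closed': "set_pmf (R t y) \<subseteq> C'" if "0 \<le> t" "y \<in> C'" for t y
    using transition_function_closed[OF tfR C'] that by blast
  define e where "e t k = measure_pmf.expectation (P t (fst k)) (\<lambda>z. D z (snd k))
      - measure_pmf.expectation (R t (snd k)) (D (fst k))" for t and k
  have derivP: "((\<lambda>t. pmf (P t x) z) has_real_derivative Q x z) (at 0 within {0..})"
    if "x \<in> C" "z \<in> C" for x z
    using tfP C(2) that unfolding transition_function_def by blast
  have derivR: "((\<lambda>t. pmf (R t y) z) has_real_derivative Q' y z) (at 0 within {0..})"
    if "y \<in> C'" "z \<in> C'" for y z
    using tfR C'(2) that unfolding transition_function_def by blast
  have expC: "measure_pmf.expectation (P t x) f = (\<Sum>z\<in>C. f z * pmf (P t x) z)"
    if "0 \<le> t" "x \<in> C" for t x f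
    using closed[OF that] C(1) by (intro integral_measure_pmf_real) auto
  have expC': "measure_pmf.expectation (R t y) f = (\<Sum>z\<in>C'. f z * pmf (R t y) z)"
    if "0 \<le> t" "y \<in> C'" for t y f
    using closed'[OF that] C'(1) by (intro integral_measure_pmf_real) auto
  have e_eq: "e t (x, y) = (\<Sum>z\<in>C. D z y * pmf (P t x) z) - (\<Sum>z\<in>C'. D x z * pmf (R t y) z)"
    if "0 \<le> t" "x \<in> C" "y \<in> C'" for t x y
    using that by (simp add: e_def expC expC')
  have "e t (x, y) = 0"
  proof (rule subadditive_zero_derivative_eq_0[of "C \<times> C'" e])
    show "finite (C \<times> C')" using C(1) C'(1) by simp
    show "0 \<le> t" "(x, y) \<in> C \<times> C'" using t x y by auto
  next
    fix k assume "k \<in> C \<times> C'"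
    then have "P 0 (fst k) = return_pmf (fst k)" "R 0 (snd k) = return_pmf (snd k)"
      using tfP tfR C(2) C'(2) unfolding transition_function_def by auto
    then show "e 0 k = 0" by (simp add: e_def)
  next
    fix k assume "k \<in> C \<times> C'"
    then obtain x y where k: "k = (x, y)" and x: "x \<in> C" and y: "y \<in> C'" by auto
    have "((\<lambda>t. (\<Sum>z\<in>C. D z y * pmf (P t x) z) - (\<Sum>z\<in>C'. D x z * pmf (R t y) z))
        has_real_derivative (\<Sum>z\<in>C. D z y * Q x z) - (\<Sum>z\<in>C'. D x z * Q' y z)) (at 0 within {0..})"
      using x y by (intro DERIV_diff DERIV_sum DERIV_cmult derivP derivR)
    moreover have "(\<Sum>z\<in>C. D z y * Q x z) - (\<Sum>z\<in>C'. D x z * Q' y z) = 0"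
      using duality[OF x y] by (simp add: mult.commute)
    ultimately have *: "((\<lambda>t. (\<Sum>z\<in>C. D z y * pmf (P t x) z) - (\<Sum>z\<in>C'. D x z * pmf (R t y) z))
        has_real_derivative 0) (at 0 within {0..})" by simp
    \<comment> \<open>The finite-sum form of \<open>e\<close> is available only for
      \<open>t \<ge> 0\<close>, which suffices for a one-sided derivative.\<close>
    show "((\<lambda>t. e t k) has_real_derivative 0) (at 0 within {0..})"
      by (rule has_field_derivative_transform_within[OF *, where d = 1])
        (auto simp: k e_eq x y)
  next
    fix s t a b :: real
    assume st: "0 \<le> s" "0 \<le> t" and a: "\<forall>k\<in>C \<times> C'. \<bar>e s k\<bar> \<le> a"
      and b: "\<forall>k\<in>C \<times> C'. \<bar>e t k\<bar> \<le> b"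
    show "\<forall>k\<in>C \<times> C'. \<bar>e (s + t) k\<bar> \<le> a + b"
    proof
      fix k assume "k \<in> C \<times> C'"
      then obtain x y where k: "k = (x, y)" and x: "x \<in> C" and y: "y \<in> C'" by auto
      \<comment> \<open>The second semigroup is split in the opposite order, so that both first
        stages, \<open>P s\<close> and \<open>R t\<close>, meet in the same mixed average.\<close>
      have "P (s + t) x = bind_pmf (P s x) (P t)" "R (t + s) y = bind_pmf (R t y) (R s)"
        using tfP tfR x y st C(2) C'(2) unfolding transition_function_def by auto
      then have "e (s + t) k
          = (\<Sum>z\<in>C. pmf (P s x) z * measure_pmf.expectation (P t z) (\<lambda>z. D z y))
            - (\<Sum>w\<in>C'. pmf (R t y) w * measure_pmf.expectation (R s w) (D x))"
        using closed closed' st x y C(1) C'(1)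
        by (simp add: e_def k expectation_bind_pmf_finite[where C = C]
            expectation_bind_pmf_finite[where C = C'] add.commute[of s])
      also have "\<dots> = (\<Sum>z\<in>C. pmf (P s x) z * e t (z, y)) + (\<Sum>w\<in>C'. pmf (R t y) w * e s (x, w))"
      proof -
        have "(\<Sum>z\<in>C. pmf (P s x) z * measure_pmf.expectation (R t y) (D z))
            = (\<Sum>z\<in>C. \<Sum>w\<in>C'. pmf (P s x) z * (D z w * pmf (R t y) w))"
          using st y by (simp add: expC' sum_distrib_left)
        also have "\<dots> = (\<Sum>w\<in>C'. \<Sum>z\<in>C. pmf (P s x) z * (D z w * pmf (R t y) w))"
          by (rule sum.swap)
        also have "\<dots> = (\<Sum>w\<in>C'. pmf (R t y) w * measure_pmf.expectation (P s x) (\<lambda>z. D z w))"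
          using st x by (simp add: expC sum_distrib_left mult_ac)
        finally show ?thesis
          by (simp add: e_def right_diff_distrib sum_subtractf)
      qed
      finally have "\<bar>e (s + t) k\<bar> \<le> \<bar>\<Sum>z\<in>C. pmf (P s x) z * e t (z, y)\<bar>
          + \<bar>\<Sum>w\<in>C'. pmf (R t y) w * e s (x, w)\<bar>"
        by linarith
      moreover have "\<bar>\<Sum>z\<in>C. pmf (P s x) z * e t (z, y)\<bar> \<le> b"
        using closed[OF st(1) x] C(1) b y by (intro abs_sum_pmf_mult_le) auto
      moreover have "\<bar>\<Sum>w\<in>C'. pmf (R t y) w * e s (x, w)\<bar> \<le> a"
        using closed'[OF st(2) y] C'(1) a x by (intro abs_sum_pmf_mult_le) auto
      ultimately show "\<bar>e (s + t) k\<bar> \<le> a + b" by linarith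
    qed
  qed
  then show ?thesis by (simp add: e_def)
qed

subsection \<open>Expectations along a Markov chain\<close>

text \<open>The Markov property at time 0 with empty \<open>J\<close>, combined with the almost sure
  initial value, already determines the one-dimensional laws.\<close>

lemma markov_chain_law:
  assumes mc: "markov_chain S Q x0 M X" and x0: "x0 \<in> S"
  obtains P where "transition_function S Q P"
    and "\<And>t y. 0 \<le> t \<Longrightarrow> y \<in> S \<Longrightarrow> measure M {\<omega> \<in> space M. X t \<omega> = y} = pmf (P t x0) y"
proof -
  interpret prob_space M using mc by (simp add: markov_chain_def)
  from mc obtain P where tf: "transition_function S Q P"
    and markov: "\<forall>s\<ge>0. \<forall>t\<ge>0. \<forall>J z. \<forall>x\<in>S. \<forall>y\<in>S. finite J \<and> J \<subseteq> {0..s} \<longrightarrow>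
           \<P>(\<omega> in M. (\<forall>u\<in>J. X u \<omega> = z u) \<and> X s \<omega> = x \<and> X (s + t) \<omega> = y) =
           \<P>(\<omega> in M. (\<forall>u\<in>J. X u \<omega> = z u) \<and> X s \<omega> = x) * pmf (P t x) y"
    unfolding markov_chain_def by (elim conjE exE)
  have X: "X t \<in> M \<rightarrow>\<^sub>M count_space S" if "0 \<le> t" for t
    using mc that by (simp add: markov_chain_def)
  have level: "{\<omega> \<in> space M. X t \<omega> = y} \<in> events" if "0 \<le> t" "y \<in> S" for t y
    using measurable_sets[OF X[OF that(1)], of "{y}"] that
    by (simp add: vimage_def Int_def conj_commute)
  have start: "AE \<omega> in M. X 0 \<omega> = x0"
    using mc by (simp add: markov_chain_def)
  have "\<P>(\<omega> in M. X t \<omega> = y) = pmf (P t x0) y" if t: "0 \<le> t" and y: "y \<in> S" for t y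
  proof -
    have "\<P>(\<omega> in M. X 0 \<omega> = x0 \<and> X t \<omega> = y) = \<P>(\<omega> in M. X 0 \<omega> = x0) * pmf (P t x0) y"
      using markov[rule_format, where s = 0 and J = "{}" and t = t and x = x0 and y = y] t x0 y by simp
    moreover have "\<P>(\<omega> in M. X 0 \<omega> = x0) = 1"
      using start level[of 0 x0] x0 by (simp add: prob_Collect_eq_1)
    moreover have "\<P>(\<omega> in M. X 0 \<omega> = x0 \<and> X t \<omega> = y) = \<P>(\<omega> in M. X t \<omega> = y)"
      using start level[of 0 x0] level[OF t y] x0
      by (intro finite_measure_eq_AE) (auto simp: Collect_conj_eq[symmetric] intro: sets.sets_Collect_conj)
    ultimately show ?thesis by simp
  qed
  with tf that show ?thesis by blast
qed

text \<open>The level probabilities over \<open>C\<close> sum to 1, so \<open>X\<close> lies in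
  \<open>C\<close> almost surely and \<open>f (X \<omega>)\<close> agrees almost surely with the
  simple function \<open>g\<close>. This gives integrability for arbitrary \<open>f\<close>.\<close>

lemma (in prob_space) expectation_eq_pmf_expectation:
  fixes f :: "'s \<Rightarrow> real"
  assumes X: "X \<in> M \<rightarrow>\<^sub>M count_space S" and C: "finite C" "C \<subseteq> S" and p: "set_pmf p \<subseteq> C"
    and law: "\<And>y. y \<in> C \<Longrightarrow> prob {\<omega> \<in> space M. X \<omega> = y} = pmf p y"
  shows "integrable M (\<lambda>\<omega>. f (X \<omega>))" and "expectation (\<lambda>\<omega>. f (X \<omega>)) = measure_pmf.expectation p f"
proof -
  define g where "g \<omega> = (\<Sum>y\<in>C. f y * indicator {\<omega> \<in> space M. X \<omega> = y} \<omega>)" for \<omega>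
  have level: "{\<omega> \<in> space M. X \<omega> = y} \<in> events" if "y \<in> C" for y
    using measurable_sets[OF X, of "{y}"] that C(2)
    by (auto simp: vimage_def Int_def conj_commute subset_iff)
  have UN: "{\<omega> \<in> space M. X \<omega> \<in> C} = (\<Union>y\<in>C. {\<omega> \<in> space M. X \<omega> = y})"
    by auto
  have "prob {\<omega> \<in> space M. X \<omega> \<in> C} = (\<Sum>y\<in>C. prob {\<omega> \<in> space M. X \<omega> = y})"
    unfolding UN using C(1) level by (intro finite_measure_finite_Union) (auto simp: disjoint_family_on_def)
  also have "\<dots> = 1"
    using law C(1) p by (simp add: sum_pmf_eq_1)
  finally have "AE \<omega> in M. X \<omega> \<in> C"
    using C(1) level by (subst (asm) prob_Collect_eq_1) (auto simp: UN)
  then have ae: "AE \<omega> in M. f (X \<omega>) = g \<omega>"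
    using AE_space by eventually_elim (simp add: g_def C(1) indicator_def of_bool_def[symmetric] eq_commute)
  have int: "integrable M g"
    unfolding g_def using level by (intro Bochner_Integration.integrable_sum integrable_mult_right) (auto simp: emeasure_eq_measure)
  have meas: "(\<lambda>\<omega>. f (X \<omega>)) \<in> borel_measurable M"
    using X by (rule measurable_compose) simp
  show "integrable M (\<lambda>\<omega>. f (X \<omega>))"
    using integrable_cong_AE[OF meas borel_measurable_integrable[OF int] ae] int by simp
  have "expectation (\<lambda>\<omega>. f (X \<omega>)) = expectation g"
    using meas int ae by (intro integral_cong_AE) auto
  also have "\<dots> = (\<Sum>y\<in>C. f y * pmf p y)"
    unfolding g_def using level law
    by (subst Bochner_Integration.integral_sum) (auto simp: emeasure_eq_measure intro!: sum.cong)
  also have "\<dots> = measure_pmf.expectation p f"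
    using C(1) p by (intro integral_measure_pmf_real[symmetric]) auto
  finally show "expectation (\<lambda>\<omega>. f (X \<omega>)) = measure_pmf.expectation p f" .
qed

subsection \<open>Terminating q-binomial theorem\<close>

lemma q_pochhammer_0 [simp]: "q_pochhammer a r 0 = 1"
  by (simp add: q_pochhammer_def)

lemma q_pochhammer_Suc: "q_pochhammer a r (Suc k) = q_pochhammer a r k * (1 - a * r ^ k)"
  by (simp add: q_pochhammer_def)

lemma q_pochhammer_Suc_left: "q_pochhammer a r (Suc k) = (1 - a) * q_pochhammer (a * r) r k"
  unfolding q_pochhammer_def by (subst prod.lessThan_Suc_shift) (simp add: mult_ac)

lemma q_pochhammer_neq_0:
  assumes "0 < r" "r < 1"
  shows "q_pochhammer r r k \<noteq> 0"
proof -
  have "1 - r * r ^ j \<noteq> 0" for j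
    using assms power_less_one_iff[of r "Suc j"] by simp
  then show ?thesis by (simp add: q_pochhammer_def)
qed

text \<open>Induction on \<open>m\<close>: with \<open>b = r powi (- int (Suc m))\<close>, a
  Pascal-type rule for the coefficients shows that passing from \<open>m\<close> to
  \<open>Suc m\<close> multiplies the series by \<open>1 - b * z\<close>.\<close>

lemma phi_1_0_eq_q_pochhammer:
  fixes r z :: real
  assumes r: "0 < r" "r < 1"
  shows "phi_1_0 m r z = q_pochhammer (z * r powi (- int m)) r m"
proof (induction m)
  case 0
  then show ?case by (simp add: phi_1_0_def)
next
  case (Suc m)
  define a where "a = r powi (- int m)"
  define b where "b = r powi (- int (Suc m))"
  define c where "c k = q_pochhammer a r k / q_pochhammer r r k" for k
  have "a = r powi (- int (Suc m) + 1)"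
    by (simp add: a_def)
  then have ab: "a = b * r"
    by (metis b_def order_less_irrefl power_int_add_1 r(1))
  have coeff: "q_pochhammer b r (Suc k) / q_pochhammer r r (Suc k) = c (Suc k) - b * c k" for k
  proof -
    have rk: "1 - r * r ^ k \<noteq> 0"
      using q_pochhammer_neq_0[OF r, of "Suc k"] by (simp add: q_pochhammer_Suc)
    have left: "q_pochhammer b r (Suc k) = (1 - b) * q_pochhammer a r k"
      by (simp add: q_pochhammer_Suc_left ab)
    show ?thesis
      unfolding c_def left unfolding q_pochhammer_Suc
      using rk q_pochhammer_neq_0[OF r, of k] by (simp add: field_simps ab)
  qed
  \<comment> \<open>The last factor of the numerator is \<open>1 - a * r ^ m = 0\<close>; this is
    what terminates the series.\<close>
  have c_top: "c (Suc m) = 0"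
    using r by (simp add: c_def q_pochhammer_Suc a_def power_int_minus)
  have "phi_1_0 (Suc m) r z = 1 + (\<Sum>k\<le>m. (c (Suc k) - b * c k) * z ^ Suc k)"
    unfolding phi_1_0_def b_def[symmetric] by (subst sum.atMost_Suc_shift) (simp add: coeff)
  also have "\<dots> = (1 + (\<Sum>k\<le>m. c (Suc k) * z ^ Suc k)) - b * z * (\<Sum>k\<le>m. c k * z ^ k)"
    by (simp add: sum_subtractf sum_distrib_left algebra_simps)
  also have "1 + (\<Sum>k\<le>m. c (Suc k) * z ^ Suc k) = (\<Sum>k\<le>Suc m. c k * z ^ k)"
    by (subst sum.atMost_Suc_shift) (simp add: c_def)
  also have "\<dots> = (\<Sum>k\<le>m. c k * z ^ k)"
    by (simp add: c_top)
  finally have "phi_1_0 (Suc m) r z = (\<Sum>k\<le>m. c k * z ^ k) - b * z * (\<Sum>k\<le>m. c k * z ^ k)" .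
  moreover have "(\<Sum>k\<le>m. c k * z ^ k) = q_pochhammer (z * a) r m"
    using Suc by (simp add: phi_1_0_def c_def a_def)
  moreover have "q_pochhammer (z * b) r (Suc m) = (1 - z * b) * q_pochhammer (z * a) r m"
    by (simp add: q_pochhammer_Suc_left ab mult.assoc)
  ultimately show ?case
    unfolding b_def[symmetric] by (simp add: left_diff_distrib mult_ac)
qed

text \<open>The two products agree factor by factor: the q-binomial theorem multiplies the argument
  by \<open>(q\<^sup>2) powi (- int (v x))\<close>, which turns \<open>N_minus (x - 1)\<close> into
  \<open>N_minus x\<close>.\<close>

lemma D_phi_eq_D_poch:
  assumes q: "0 < q" "q < 1"
  shows "D_phi q n L \<xi> \<eta> = D_poch q n L \<xi> \<eta>"
proof -
  have "phi_1_0 (v x) (q\<^sup>2) (q powi (- 2 * int (N_minus (x - 1) v + m) + 1))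
      = q_pochhammer (q powi (- 2 * int (N_minus x v + m) + 1)) (q\<^sup>2) (v x)"
    if x: "x \<in> {1..L}" for x v m
  proof -
    obtain y where y: "x = Suc y"
      using x by (cases x) auto
    have "q powi (- 2 * int (N_minus (x - 1) v + m) + 1) * (q\<^sup>2) powi (- int (v x))
        = q powi (- 2 * int (N_minus (x - 1) v + m) + 1 + - 2 * int (v x))"
      using q by (subst power_int_add) (auto simp: power_int_power power_int_mult)
    also have "- 2 * int (N_minus (x - 1) v + m) + 1 + - 2 * int (v x)
        = - 2 * int (N_minus x v + m) + 1"
      by (simp add: y N_minus_def)
    finally show ?thesis
      using q by (subst phi_1_0_eq_q_pochhammer) (auto simp: power_less_one_iff)
  qed
  then show ?thesis
    unfolding D_phi_def D_poch_def by (intro arg_cong2[where f = "(*)"] refl prod.cong) auto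
qed

subsection \<open>Effect of a single jump on the duality function\<close>

text \<open>As in \<open>move\<close>, the truncated subtraction is meaningful only if \<open>v x > 0\<close>.\<close>

definition shift :: "(nat \<Rightarrow> nat) \<Rightarrow> nat \<Rightarrow> nat \<Rightarrow> nat \<Rightarrow> nat" where
  "shift v x y = v(x := v x - 1, y := v y + 1)"

lemma move_eq_shift: "move \<xi> k x y = \<xi>(k := shift (\<xi> k) x y)"
  by (simp add: move_def shift_def)

text \<open>Both corrections are added rather than subtracted, which avoids truncated subtraction on
  naturals.\<close>

lemma sum_shift:
  assumes "finite A" "v x > 0" "x \<noteq> y"
  shows "sum (shift v x y) A + of_bool (x \<in> A) = sum v A + of_bool (y \<in> A)"
proof -
  have pointwise: "shift v x y z + of_bool (z = x) = v z + of_bool (z = y)" for z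
    using assms(2,3) by (auto simp: shift_def)
  have "sum (shift v x y) A + (\<Sum>z\<in>A. of_bool (z = x)) = sum v A + (\<Sum>z\<in>A. of_bool (z = y))"
    unfolding sum.distrib[symmetric] pointwise ..
  then show ?thesis
    using assms(1) by (simp add: of_bool_def)
qed

text \<open>A jump across the bond between \<open>x\<close> and \<open>x + 1\<close> is visible only
  to the partial sum that ends at \<open>x\<close>; every other one contains both sites or
  neither.\<close>

lemma N_minus_shift_right:
  assumes "v x > 0" "1 \<le> x"
  shows "N_minus y (shift v x (x + 1)) + of_bool (y = x) = N_minus y v"
proof -
  have "N_minus y (shift v x (x + 1)) + of_bool (x \<in> {1..y}) = N_minus y v + of_bool (x + 1 \<in> {1..y})"
    unfolding N_minus_def using assms by (intro sum_shift) auto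
  then show ?thesis
    using assms(2) by (cases "y = x") (auto simp: of_bool_def split: if_splits)
qed

lemma N_minus_shift_left:
  assumes "w (x + 1) > 0" "1 \<le> x"
  shows "N_minus y (shift w (x + 1) x) = N_minus y w + of_bool (y = x)"
proof -
  have "N_minus y (shift w (x + 1) x) + of_bool (x + 1 \<in> {1..y}) = N_minus y w + of_bool (x \<in> {1..y})"
    unfolding N_minus_def using assms by (intro sum_shift) auto
  then show ?thesis
    using assms(2) by (cases "y = x") (auto simp: of_bool_def split: if_splits)
qed

lemma N_plus_shift_left:
  assumes "w (x + 1) > 0" "x < L"
  shows "N_plus L (y + 1) (shift w (x + 1) x) + of_bool (y = x) = N_plus L (y + 1) w"
proof -
  have "N_plus L (y + 1) (shift w (x + 1) x) + of_bool (x + 1 \<in> {y + 1..L})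
      = N_plus L (y + 1) w + of_bool (x \<in> {y + 1..L})"
    unfolding N_plus_def using assms by (intro sum_shift) auto
  then show ?thesis
    using assms(2) by (cases "y = x") (auto simp: of_bool_def split: if_splits)
qed

lemma N_plus_Suc: "x \<le> L \<Longrightarrow> N_plus L x v = v x + N_plus L (x + 1) v"
  unfolding N_plus_def by (subst sum.atLeast_Suc_atMost) auto

lemma N_minus_Suc: "N_minus (x + 1) v = N_minus x v + v (x + 1)"
  by (simp add: N_minus_def)

text \<open>
  Exchanging the two species indices in the second term of \<open>h_exponent\<close> merges both of its
  terms into this bilinear form of \<open>\<xi> i\<close> and \<open>\<eta> j\<close>, summed over \<open>i + j < n - 1\<close>.
\<close>

definition h_pair :: "nat \<Rightarrow> (nat \<Rightarrow> nat) \<Rightarrow> (nat \<Rightarrow> nat) \<Rightarrow> int" where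
  "h_pair L v w = (\<Sum>y=1..L. int (v y) * (int (N_minus y w) - int (N_plus L (y + 1) w)))"

lemma h_exponent_eq: "h_exponent n L \<xi> \<eta> = (\<Sum>i<n. \<Sum>j<n - 1 - i. h_pair L (\<xi> i) (\<eta> j))"
proof -
  have N_below: "int (N_plus L x (below \<zeta> m)) = (\<Sum>j<m. int (N_plus L x (\<zeta> j)))" for x m \<zeta>
    unfolding N_plus_def below_def of_nat_sum by (rule sum.swap)
  have swap: "(\<Sum>x=1..L. int (w x) * int (N_plus L x v)) = (\<Sum>y=1..L. int (v y) * int (N_minus y w))"
    for v w
  proof -
    have "(\<Sum>x=1..L. int (w x) * int (N_plus L x v)) = (\<Sum>x=1..L. \<Sum>y=x..L. int (w x) * int (v y))"
      by (simp add: N_plus_def sum_distrib_left)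
    also have "\<dots> = (\<Sum>y=1..L. \<Sum>x=1..y. int (w x) * int (v y))"
      unfolding sum.Sigma[OF finite_atLeastAtMost ballI[OF finite_atLeastAtMost]]
      by (rule sum.reindex_bij_witness[of _ "\<lambda>(a, b). (b, a)" "\<lambda>(a, b). (b, a)"]) auto
    also have "\<dots> = (\<Sum>y=1..L. int (v y) * int (N_minus y w))"
      by (simp add: N_minus_def sum_distrib_left mult.commute)
    finally show ?thesis .
  qed
  define B where "B v w = (\<Sum>y=1..L. int (v y) * int (N_minus y w))" for v w
  define A where "A v w = (\<Sum>y=1..L. int (v y) * int (N_plus L (y + 1) w))" for v w
  have "h_exponent n L \<xi> \<eta>
      = (\<Sum>i<n. (\<Sum>x=1..L. \<Sum>j<n - 1 - i. int (\<eta> i x) * int (N_plus L x (\<xi> j)))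
            - (\<Sum>x=1..L. \<Sum>j<n - 1 - i. int (\<xi> i x) * int (N_plus L (x + 1) (\<eta> j))))"
    unfolding h_exponent_def N_below sum_distrib_left
    by (subst sum.swap) (simp add: sum_subtractf)
  also have "\<dots> = (\<Sum>i<n. (\<Sum>j<n - 1 - i. B (\<xi> j) (\<eta> i)) - (\<Sum>j<n - 1 - i. A (\<xi> i) (\<eta> j)))"
    unfolding B_def A_def swap[symmetric]
    by (rule sum.cong[OF refl], rule arg_cong2[where f = "(-)"]; rule sum.swap)
  also have "\<dots> = (\<Sum>i<n. \<Sum>j<n - 1 - i. B (\<xi> j) (\<eta> i)) - (\<Sum>i<n. \<Sum>j<n - 1 - i. A (\<xi> i) (\<eta> j))"
    by (simp add: sum_subtractf)
  \<comment> \<open>The index region \<open>i + j < n - 1\<close> is symmetric, so the two species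
    indices may be exchanged.\<close>
  also have "(\<Sum>i<n. \<Sum>j<n - 1 - i. B (\<xi> j) (\<eta> i)) = (\<Sum>i<n. \<Sum>j<n - 1 - i. B (\<xi> i) (\<eta> j))"
    unfolding sum.Sigma[OF finite_lessThan ballI[OF finite_lessThan]]
    by (rule sum.reindex_bij_witness[of _ "\<lambda>(a, b). (b, a)" "\<lambda>(a, b). (b, a)"]) auto
  finally show ?thesis
    by (simp only: A_def B_def h_pair_def sum_subtractf right_diff_distrib)
qed

text \<open>The jump replaces the weight \<open>f x\<close> by \<open>f (x + 1)\<close>. The
  particles of \<open>w\<close> at \<open>x + 1\<close> enter the \<open>N_minus\<close> part and
  leave the subtracted \<open>N_plus\<close> part, so they count twice.\<close>

lemma h_pair_shift_right:
  assumes "v x > 0" "1 \<le> x" "x < L"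
  shows "h_pair L (shift v x (x + 1)) w = h_pair L v w + 2 * int (w (x + 1))"
proof -
  define f where "f y = int (N_minus y w) - int (N_plus L (y + 1) w)" for y
  have pointwise: "int (shift v x (x + 1) y) * f y
      = int (v y) * f y + (of_bool (y = x + 1) * f y - of_bool (y = x) * f y)" for y
    using assms(1) by (auto simp: shift_def algebra_simps of_nat_diff)
  have "h_pair L (shift v x (x + 1)) w = h_pair L v w + (f (x + 1) - f x)"
    unfolding h_pair_def f_def[symmetric] pointwise sum.distrib sum_subtractf
    using assms by (simp add: of_bool_def if_distrib[where f = "\<lambda>t. t * _"] cong: if_cong)
  also have "f (x + 1) - f x = 2 * int (w (x + 1))"
    using N_minus_Suc[of x w] N_plus_Suc[of "x + 1" L w] assms by (simp add: f_def)
  finally show ?thesis .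
qed

text \<open>Only the weight at \<open>x\<close> changes: \<open>N_minus\<close> gains one particle
  there and the subtracted \<open>N_plus\<close> loses one.\<close>

lemma h_pair_shift_left:
  assumes "w (x + 1) > 0" "1 \<le> x" "x < L"
  shows "h_pair L v (shift w (x + 1) x) = h_pair L v w + 2 * int (v x)"
proof -
  have pointwise: "int (v y) * (int (N_minus y (shift w (x + 1) x)) - int (N_plus L (y + 1) (shift w (x + 1) x)))
      = int (v y) * (int (N_minus y w) - int (N_plus L (y + 1) w)) + of_bool (y = x) * (2 * int (v y))" for y
    using N_minus_shift_left[of w x y] N_plus_shift_left[of w x L y, symmetric] assms
    by (simp add: algebra_simps)
  show ?thesis
    unfolding h_pair_def pointwise sum.distrib
    using assms by (simp add: of_bool_def if_distrib[where f = "\<lambda>t. t * _"] cong: if_cong)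
qed

lemma h_exponent_move_right:
  assumes "\<xi> k x > 0" "1 \<le> x" "x < L" "k < n"
  shows "h_exponent n L (move \<xi> k x (x + 1)) \<eta>
    = h_exponent n L \<xi> \<eta> + 2 * int (below \<eta> (n - 1 - k) (x + 1))"
proof -
  have pointwise: "(\<Sum>j<n - 1 - i. h_pair L (move \<xi> k x (x + 1) i) (\<eta> j))
      = (\<Sum>j<n - 1 - i. h_pair L (\<xi> i) (\<eta> j))
        + (if i = k then 2 * int (below \<eta> (n - 1 - k) (x + 1)) else 0)" for i
    using assms h_pair_shift_right[of "\<xi> k" x L]
    by (simp add: move_eq_shift sum.distrib below_def sum_distrib_left)
  show ?thesis
    unfolding h_exponent_eq pointwise sum.distrib using assms(4) by simp
qed

text \<open>Species \<open>n - 1 - k\<close> of \<eta> occurs in the inner sum for \<open>i\<close>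
  exactly when \<open>i < k\<close>, and each such \<open>i\<close> contributes
  \<open>2 * int (\<xi> i x)\<close>.\<close>

lemma h_exponent_move_left:
  assumes "\<eta> (n - 1 - k) (x + 1) > 0" "1 \<le> x" "x < L" "k < n"
  shows "h_exponent n L \<xi> (move \<eta> (n - 1 - k) (x + 1) x)
    = h_exponent n L \<xi> \<eta> + 2 * int (below \<xi> k x)"
proof -
  have pointwise: "(\<Sum>j<n - 1 - i. h_pair L (\<xi> i) (move \<eta> (n - 1 - k) (x + 1) x j))
      = (\<Sum>j<n - 1 - i. h_pair L (\<xi> i) (\<eta> j)) + (if i < k then 2 * int (\<xi> i x) else 0)"
    if "i < n" for i
  proof -
    have "(\<Sum>j<n - 1 - i. h_pair L (\<xi> i) (move \<eta> (n - 1 - k) (x + 1) x j))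
      = (\<Sum>j<n - 1 - i. h_pair L (\<xi> i) (\<eta> j) + (if j = n - 1 - k then 2 * int (\<xi> i x) else 0))"
      using assms by (intro sum.cong) (auto simp: move_eq_shift h_pair_shift_left simp del: One_nat_def)
    then show ?thesis
      using assms(4) that by (auto simp: sum.distrib)
  qed
  have "{i. i < n \<and> i < k} = {..<k}"
    using assms(4) by auto
  then have "(\<Sum>i<n. if i < k then 2 * int (\<xi> i x) else 0) = 2 * int (below \<xi> k x)"
    by (simp add: sum.If_cases below_def sum_distrib_left Int_def lessThan_def)
  moreover have "h_exponent n L \<xi> (move \<eta> (n - 1 - k) (x + 1) x)
      = (\<Sum>i<n. (\<Sum>j<n - 1 - i. h_pair L (\<xi> i) (\<eta> j)) + (if i < k then 2 * int (\<xi> i x) else 0))"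
    unfolding h_exponent_eq by (rule sum.cong[OF refl], rule pointwise) simp
  ultimately show ?thesis
    by (simp only: h_exponent_eq sum.distrib)
qed

section \<open>The q-Pochhammer factors under a jump\<close>

lemma powi_odd_eq:
  fixes q :: real
  assumes "q > 0"
  shows "q powi (- 2 * int m + 1) = q / (q\<^sup>2) ^ m"
proof -
  have "q powi (- 2 * int m + 1) = q powi (- int (2 * m)) * q"
    using assms by (subst power_int_add) auto
  also have "q powi (- int (2 * m)) = inverse ((q\<^sup>2) ^ m)"
    unfolding power_int_minus power_int_of_nat power_mult ..
  finally show ?thesis
    by (simp add: divide_inverse mult.commute)
qed

text \<open>At the left end of a bond and for paired species \<open>v\<close> of \<xi> and
  \<open>w\<close> of \<eta>, this is the number \<open>a\<close> in which the effects of both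
  opposite jumps are expressed.\<close>

definition site_base :: "real \<Rightarrow> nat \<Rightarrow> (nat \<Rightarrow> nat) \<Rightarrow> (nat \<Rightarrow> nat) \<Rightarrow> nat \<Rightarrow> real" where
  "site_base q L v w x = q powi (- 2 * int (N_minus x v + N_plus L (x + 1) w) + 1)"

lemma site_base_eq:
  "q > 0 \<Longrightarrow> site_base q L v w x = q / (q\<^sup>2) ^ (N_minus x v + N_plus L (x + 1) w)"
  unfolding site_base_def by (rule powi_odd_eq)

text \<open>An odd power of \<open>q\<close> is never 1. This permits the later division by
  \<open>1 - a\<close>.\<close>

lemma site_base_neq_1:
  assumes q: "0 < q" "q < 1"
  shows "site_base q L v w x \<noteq> 1"
proof
  define m where "m = N_minus x v + N_plus L (x + 1) w"
  assume "site_base q L v w x = 1"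
  then have "q / (q\<^sup>2) ^ m = 1"
    using q(1) by (simp only: site_base_eq m_def)
  then have eq: "q ^ 1 = q ^ (2 * m)"
    by (simp add: power_mult divide_eq_1_iff)
  have "1 \<noteq> 2 * m" by presburger
  then consider "1 < 2 * m" | "2 * m < 1" by linarith
  then show False
    using eq q power_strict_decreasing[of 1 "2 * m" q] power_strict_decreasing[of "2 * m" 1 q]
    by cases auto
qed

definition species_factor :: "real \<Rightarrow> nat \<Rightarrow> (nat \<Rightarrow> nat) \<Rightarrow> (nat \<Rightarrow> nat) \<Rightarrow> real" where
  "species_factor q L v w = (\<Prod>x=1..L. q_pochhammer (site_base q L v w x) (q\<^sup>2) (v x))"

lemma D_poch_eq:
  "D_poch q n L \<xi> \<eta> = q powi h_exponent n L \<xi> \<eta> * (\<Prod>i<n. species_factor q L (\<xi> i) (\<eta> (n - 1 - i)))"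
  by (simp add: D_poch_def species_factor_def site_base_def)

text \<open>Only two factors change. At \<open>x\<close> the base becomes
  \<open>a * q\<^sup>2\<close> and the length drops by one, so the first factor \<open>1 - a\<close>
  is lost; at \<open>x + 1\<close> the base stays and one last factor is gained.\<close>

lemma species_factor_shift_right:
  assumes q: "0 < q" and v: "v x > 0" and x: "1 \<le> x" "x < L"
  shows "species_factor q L (shift v x (x + 1)) w * (1 - site_base q L v w x)
    = species_factor q L v w * (1 - site_base q L v w x * (q\<^sup>2) ^ w (x + 1))"
proof -
  define v' where "v' = shift v x (x + 1)"
  define a where "a = site_base q L v w x"
  define f where "f y = q_pochhammer (site_base q L v w y) (q\<^sup>2) (v y)" for y
  define f' where "f' y = q_pochhammer (site_base q L v' w y) (q\<^sup>2) (v' y)" for y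
  have N: "N_minus y v' + of_bool (y = x) = N_minus y v" for y
    unfolding v'_def using v x(1) by (rule N_minus_shift_right)
  have split: "prod g {1..L} = g x * (g (x + 1) * prod g ({1..L} - {x} - {x + 1}))" for g :: "nat \<Rightarrow> real"
    using x prod.remove[of "{1..L}" x g] prod.remove[of "{1..L} - {x}" "x + 1" g] by simp
  have rest: "prod f' ({1..L} - {x} - {x + 1}) = prod f ({1..L} - {x} - {x + 1})"
  proof (rule prod.cong[OF refl])
    fix y assume "y \<in> {1..L} - {x} - {x + 1}"
    then show "f' y = f y"
      using N[of y] by (simp add: f_def f'_def site_base_def v'_def shift_def)
  qed
  have at_x: "f x = (1 - a) * f' x"
  proof -
    have vx: "v x = Suc (v' x)"
      using v by (simp add: v'_def shift_def)
    have "site_base q L v' w x = a * q\<^sup>2"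
      using q N[of x, symmetric] by (simp add: site_base_eq a_def)
    then show ?thesis
      by (simp add: f_def f'_def vx q_pochhammer_Suc_left a_def)
  qed
  have at_Suc: "f' (x + 1) = f (x + 1) * (1 - a * (q\<^sup>2) ^ w (x + 1))"
  proof -
    have vx: "v' (x + 1) = Suc (v (x + 1))"
      by (simp add: v'_def shift_def)
    have base: "site_base q L v' w (x + 1) = site_base q L v w (x + 1)"
      using N[of "x + 1"] by (simp add: site_base_def)
    \<comment> \<open>The power of \<open>v (x + 1)\<close> reduces \<open>N_minus (x + 1) v\<close>
      to \<open>N_minus x v\<close>, while \<open>N_plus L (x + 2) w\<close> falls short of
      \<open>N_plus L (x + 1) w\<close> by \<open>w (x + 1)\<close>.\<close>
    have "site_base q L v w (x + 1) * (q\<^sup>2) ^ v (x + 1) = a * (q\<^sup>2) ^ w (x + 1)"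
      using q x N_minus_Suc[of x v] N_plus_Suc[of "x + 1" L w]
      by (simp add: site_base_eq a_def power_add)
    then show ?thesis
      unfolding f_def f'_def vx base q_pochhammer_Suc by simp
  qed
  have "prod f' {1..L} * (1 - a) = prod f {1..L} * (1 - a * (q\<^sup>2) ^ w (x + 1))"
    unfolding split rest at_x at_Suc by (simp only: mult_ac)
  then show ?thesis
    by (simp only: species_factor_def f_def[abs_def] f'_def[abs_def] v'_def a_def)
qed

text \<open>Only the factor at \<open>x\<close> changes: its base moves from \<open>a\<close> to
  \<open>a * q\<^sup>2\<close> at fixed length \<open>v x\<close>, so the first factor is dropped
  and the next one is appended.\<close>

lemma species_factor_shift_left:
  assumes q: "0 < q" and w: "w (x + 1) > 0" and x: "1 \<le> x" "x < L"
  shows "species_factor q L v (shift w (x + 1) x) * (1 - site_base q L v w x)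
    = species_factor q L v w * (1 - site_base q L v w x * (q\<^sup>2) ^ v x)"
proof -
  define w' where "w' = shift w (x + 1) x"
  define a where "a = site_base q L v w x"
  define f where "f y = q_pochhammer (site_base q L v w y) (q\<^sup>2) (v y)" for y
  define f' where "f' y = q_pochhammer (site_base q L v w' y) (q\<^sup>2) (v y)" for y
  have N: "N_plus L (y + 1) w' + of_bool (y = x) = N_plus L (y + 1) w" for y
    unfolding w'_def using w x(2) by (rule N_plus_shift_left)
  have split: "prod g {1..L} = g x * prod g ({1..L} - {x})" for g :: "nat \<Rightarrow> real"
    using x prod.remove[of "{1..L}" x g] by simp
  have rest: "prod f' ({1..L} - {x}) = prod f ({1..L} - {x})"
  proof (rule prod.cong[OF refl])
    fix y assume "y \<in> {1..L} - {x}"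
    then show "f' y = f y"
      using N[of y] by (simp add: f_def f'_def site_base_def)
  qed
  have at_x: "f' x * (1 - a) = f x * (1 - a * (q\<^sup>2) ^ v x)"
  proof -
    have "site_base q L v w' x = a * q\<^sup>2"
      using q N[of x, symmetric] by (simp add: site_base_eq a_def)
    then have "f' x * (1 - a) = q_pochhammer a (q\<^sup>2) (Suc (v x))"
      by (simp add: f'_def q_pochhammer_Suc_left)
    then show ?thesis
      by (simp add: q_pochhammer_Suc f_def a_def)
  qed
  have "prod f' {1..L} * (1 - a) = prod f ({1..L} - {x}) * (f' x * (1 - a))"
    unfolding split rest by (simp only: mult_ac)
  also have "\<dots> = prod f {1..L} * (1 - a * (q\<^sup>2) ^ v x)"
    unfolding split at_x by (simp only: mult_ac)
  finally show ?thesis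
    by (simp only: species_factor_def f_def[abs_def] f'_def[abs_def] w'_def a_def)
qed

lemma powi_add_even:
  fixes q :: real
  assumes "q > 0"
  shows "q powi (h + 2 * int m) = q powi h * (q\<^sup>2) ^ m"
proof -
  have "q powi (h + int (2 * m)) = q powi h * (q\<^sup>2) ^ m"
    using assms unfolding power_mult[symmetric] by (subst power_int_add) (auto simp del: of_nat_mult)
  then show ?thesis by simp
qed

lemma D_poch_move_right:
  fixes \<xi> \<eta> :: config
  assumes q: "0 < q" and \<xi>: "\<xi> k x > 0" and x: "1 \<le> x" "x < L" and k: "k < n"
  defines "a \<equiv> site_base q L (\<xi> k) (\<eta> (n - 1 - k)) x"
  shows "D_poch q n L (move \<xi> k x (x + 1)) \<eta> * (1 - a)
    = (q\<^sup>2) ^ below \<eta> (n - 1 - k) (x + 1) * (1 - a * (q\<^sup>2) ^ \<eta> (n - 1 - k) (x + 1)) * D_poch q n L \<xi> \<eta>"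
proof -
  define f where "f \<zeta> i = species_factor q L (\<zeta> i) (\<eta> (n - 1 - i))" for \<zeta> :: config and i
  define \<xi>' where "\<xi>' = move \<xi> k x (x + 1)"
  have split: "prod g {..<n} = g k * prod g ({..<n} - {k})" for g :: "nat \<Rightarrow> real"
    using k by (simp add: prod.remove[of "{..<n}" k])
  have rest: "prod (f \<xi>') ({..<n} - {k}) = prod (f \<xi>) ({..<n} - {k})"
    by (rule prod.cong) (auto simp: f_def \<xi>'_def move_eq_shift)
  have at_k: "f \<xi>' k * (1 - a) = f \<xi> k * (1 - a * (q\<^sup>2) ^ \<eta> (n - 1 - k) (x + 1))"
    using species_factor_shift_right[of q "\<xi> k", OF q \<xi> x, of "\<eta> (n - 1 - k)"]
    by (simp add: f_def \<xi>'_def move_eq_shift a_def)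
  have h: "q powi h_exponent n L \<xi>' \<eta>
      = q powi h_exponent n L \<xi> \<eta> * (q\<^sup>2) ^ below \<eta> (n - 1 - k) (x + 1)"
    unfolding \<xi>'_def h_exponent_move_right[where \<xi> = \<xi> and k = k, OF \<xi> x k] by (rule powi_add_even[OF q])
  have "D_poch q n L \<xi>' \<eta> * (1 - a)
      = q powi h_exponent n L \<xi>' \<eta> * ((f \<xi>' k * (1 - a)) * prod (f \<xi>') ({..<n} - {k}))"
    unfolding D_poch_eq f_def[symmetric] split by (simp only: mult_ac)
  also have "\<dots> = (q\<^sup>2) ^ below \<eta> (n - 1 - k) (x + 1) * (1 - a * (q\<^sup>2) ^ \<eta> (n - 1 - k) (x + 1)) * D_poch q n L \<xi> \<eta>"
    unfolding rest at_k h D_poch_eq f_def[symmetric] split by (simp only: mult_ac)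
  finally show ?thesis by (simp only: \<xi>'_def)
qed

lemma D_poch_move_left:
  fixes \<xi> \<eta> :: config
  assumes q: "0 < q" and \<eta>: "\<eta> (n - 1 - k) (x + 1) > 0" and x: "1 \<le> x" "x < L" and k: "k < n"
  defines "a \<equiv> site_base q L (\<xi> k) (\<eta> (n - 1 - k)) x"
  shows "D_poch q n L \<xi> (move \<eta> (n - 1 - k) (x + 1) x) * (1 - a)
    = (q\<^sup>2) ^ below \<xi> k x * (1 - a * (q\<^sup>2) ^ \<xi> k x) * D_poch q n L \<xi> \<eta>"
proof -
  define f where "f \<zeta> i = species_factor q L (\<xi> i) (\<zeta> (n - 1 - i))" for \<zeta> :: config and i
  define \<eta>' where "\<eta>' = move \<eta> (n - 1 - k) (x + 1) x"
  have split: "prod g {..<n} = g k * prod g ({..<n} - {k})" for g :: "nat \<Rightarrow> real"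
    using k by (simp add: prod.remove[of "{..<n}" k])
  have rest: "prod (f \<eta>') ({..<n} - {k}) = prod (f \<eta>) ({..<n} - {k})"
  proof (rule prod.cong[OF refl])
    fix i assume "i \<in> {..<n} - {k}"
    \<comment> \<open>Truncated subtraction is injective here because both indices are below
      \<open>n\<close>.\<close>
    then have "n - 1 - i \<noteq> n - 1 - k" using k by auto
    then show "f \<eta>' i = f \<eta> i" by (simp add: f_def \<eta>'_def move_eq_shift)
  qed
  have at_k: "f \<eta>' k * (1 - a) = f \<eta> k * (1 - a * (q\<^sup>2) ^ \<xi> k x)"
    using species_factor_shift_left[of q "\<eta> (n - 1 - k)", OF q \<eta> x, of "\<xi> k"]
    by (simp add: f_def \<eta>'_def move_eq_shift a_def)
  have h: "q powi h_exponent n L \<xi> \<eta>' = q powi h_exponent n L \<xi> \<eta> * (q\<^sup>2) ^ below \<xi> k x"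
    unfolding \<eta>'_def h_exponent_move_left[where \<eta> = \<eta>, OF \<eta> x k] by (rule powi_add_even[OF q])
  have "D_poch q n L \<xi> \<eta>' * (1 - a)
      = q powi h_exponent n L \<xi> \<eta>' * ((f \<eta>' k * (1 - a)) * prod (f \<eta>') ({..<n} - {k}))"
    unfolding D_poch_eq f_def[symmetric] split by (simp only: mult_ac)
  also have "\<dots> = (q\<^sup>2) ^ below \<xi> k x * (1 - a * (q\<^sup>2) ^ \<xi> k x) * D_poch q n L \<xi> \<eta>"
    unfolding rest at_k h D_poch_eq f_def[symmetric] split by (simp only: mult_ac)
  finally show ?thesis by (simp only: \<eta>'_def)
qed

subsection \<open>Duality of the generators\<close>

lemma below_Suc: "below \<xi> (Suc k) x = below \<xi> k x + \<xi> k x"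
  by (simp add: below_def)

lemma bond_duality:
  assumes q: "0 < q" "q < 1" and x: "1 \<le> x" "x < L"
  shows "(\<Sum>k<n. jump_rate q \<xi> k x * (D_poch q n L (move \<xi> k x (x + 1)) \<eta> - D_poch q n L \<xi> \<eta>))
    = (\<Sum>k<n. jump_rate q \<eta> k (x + 1) * (D_poch q n L \<xi> (move \<eta> k (x + 1) x) - D_poch q n L \<xi> \<eta>))"
proof -
  define d where "d = D_poch q n L \<xi> \<eta>"
  define X where "X k = (q\<^sup>2) ^ below \<xi> k x" for k
  define Y where "Y k = (q\<^sup>2) ^ below \<eta> k (x + 1)" for k
  \<comment> \<open>Up to the constant 1 this is \<open>(1 - X k) * (1 - Y (n - k))\<close>. Since
    \<open>X 0 = Y 0 = 1\<close>, it takes the same value at \<open>k = 0\<close> and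
    \<open>k = n\<close>.\<close>
  define T where "T k = X k * Y (n - k) - X k - Y (n - k)" for k
  define R where "R k = jump_rate q \<xi> k x * (D_poch q n L (move \<xi> k x (x + 1)) \<eta> - d)" for k
  define S where "S k = jump_rate q \<eta> k (x + 1) * (D_poch q n L \<xi> (move \<eta> k (x + 1) x) - d)" for k
  have q2: "1 - q\<^sup>2 \<noteq> 0"
    using q by (simp add: power_less_one_iff less_imp_neq)
  have diff: "R k - S (n - Suc k) = d / (1 - q\<^sup>2) * (T k - T (Suc k))" if k: "k < n" for k
  proof -
    define l where "l = n - 1 - k"
    define a where "a = site_base q L (\<xi> k) (\<eta> l) x"
    define u where "u = (q\<^sup>2) ^ \<xi> k x"
    define v where "v = (q\<^sup>2) ^ \<eta> l (x + 1)"
    have a: "1 - a \<noteq> 0"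
      using site_base_neq_1[OF q] by (simp add: a_def)
    have ind: "n - k = Suc l" "n - Suc k = l"
      using k by (auto simp: l_def)
    have steps: "X (Suc k) = X k * u" "Y (Suc l) = Y l * v"
      by (simp_all add: X_def Y_def u_def v_def below_Suc power_add)
    \<comment> \<open>Here \<open>s\<close> and \<open>t\<close> stand for \<open>X k\<close> and
      \<open>Y l\<close>, while \<open>i\<close> and \<open>e\<close> stand for the inverses of
      \<open>1 - q\<^sup>2\<close> and \<open>1 - a\<close>, so that the identity is purely
      polynomial.\<close>
    have ring: "s * (1 - u) * i * (d * (t * (1 - a * v) * e - 1)) - t * (1 - v) * i * (d * (s * (1 - a * u) * e - 1))
      = d * i * (s * t * (((1 - u) * (1 - a * v) - (1 - v) * (1 - a * u)) * e) - s * (1 - u) + t * (1 - v))"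
      for s t i e
      by (simp add: algebra_simps)
    have "R k = X k * (1 - u) / (1 - q\<^sup>2) * (d * (Y l * (1 - a * v) / (1 - a) - 1))"
    \<comment> \<open>Without a particle to move, \<open>move\<close> is meaningless, but the rate
      and \<open>1 - u\<close> both vanish.\<close>
    proof (cases "\<xi> k x = 0")
      case False
      then have "D_poch q n L (move \<xi> k x (x + 1)) \<eta> * (1 - a) = Y l * (1 - a * v) * d"
        using D_poch_move_right[OF q(1) _ x k, of \<xi> \<eta>] by (simp add: Y_def v_def d_def a_def l_def)
      then have "D_poch q n L (move \<xi> k x (x + 1)) \<eta> = Y l * (1 - a * v) * d / (1 - a)"
        using a by (simp add: eq_divide_eq)
      then have "D_poch q n L (move \<xi> k x (x + 1)) \<eta> - d = d * (Y l * (1 - a * v) / (1 - a) - 1)"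
        by (simp add: right_diff_distrib mult_ac)
      moreover have "jump_rate q \<xi> k x = X k * (1 - u) / (1 - q\<^sup>2)"
        by (simp add: jump_rate_def X_def u_def power_mult)
      ultimately show ?thesis by (simp only: R_def)
    qed (simp add: R_def jump_rate_def u_def)
    moreover have "S l = Y l * (1 - v) / (1 - q\<^sup>2) * (d * (X k * (1 - a * u) / (1 - a) - 1))"
    proof (cases "\<eta> l (x + 1) = 0")
      case False
      then have "D_poch q n L \<xi> (move \<eta> l (x + 1) x) * (1 - a) = X k * (1 - a * u) * d"
        using D_poch_move_left[OF q(1) _ x k, of \<eta> \<xi>] by (simp add: X_def u_def d_def a_def l_def)
      then have "D_poch q n L \<xi> (move \<eta> l (x + 1) x) = X k * (1 - a * u) * d / (1 - a)"
        using a by (simp add: eq_divide_eq)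
      then have "D_poch q n L \<xi> (move \<eta> l (x + 1) x) - d = d * (X k * (1 - a * u) / (1 - a) - 1)"
        by (simp add: right_diff_distrib mult_ac)
      moreover have "jump_rate q \<eta> l (x + 1) = Y l * (1 - v) / (1 - q\<^sup>2)"
        by (simp add: jump_rate_def Y_def v_def power_mult)
      ultimately show ?thesis by (simp only: S_def)
    qed (simp add: S_def jump_rate_def v_def)
    ultimately have "R k - S l = d / (1 - q\<^sup>2) *
       (X k * Y l * (((1 - u) * (1 - a * v) - (1 - v) * (1 - a * u)) / (1 - a)) - X k * (1 - u) + Y l * (1 - v))"
      by (simp only: divide_inverse ring)
    \<comment> \<open>The numerator factors as \<open>(1 - a) * (v - u)\<close>; all dependence on
      the configuration away from the bond that enters through \<open>a\<close> cancels.\<close>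
    also have "((1 - u) * (1 - a * v) - (1 - v) * (1 - a * u)) / (1 - a) = v - u"
      using a by (simp add: divide_eq_eq) (simp add: algebra_simps)
    also have "X k * Y l * (v - u) - X k * (1 - u) + Y l * (1 - v) = T k - T (Suc k)"
      unfolding T_def ind steps by (simp add: algebra_simps)
    finally show ?thesis by (simp add: ind)
  qed
  \<comment> \<open>Reversing the species order of \<eta> pairs \<open>k\<close> with
    \<open>n - 1 - k\<close>.\<close>
  have "(\<Sum>k<n. R k) - (\<Sum>k<n. S k) = (\<Sum>k<n. R k - S (n - Suc k))"
    by (simp add: sum_subtractf sum.nat_diff_reindex)
  also have "\<dots> = d / (1 - q\<^sup>2) * (\<Sum>k<n. T k - T (Suc k))"
    unfolding sum_distrib_left by (rule sum.cong) (auto simp: diff)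
  also have "(\<Sum>k<n. T k - T (Suc k)) = T 0 - T n"
    by (rule sum_lessThan_telescope')
  also have "T 0 - T n = 0"
    by (simp add: T_def X_def Y_def below_def)
  finally show ?thesis by (simp add: R_def S_def d_def)
qed

section \<open>Sectors of fixed particle numbers and the generators on them\<close>

definition sector :: "nat \<Rightarrow> nat \<Rightarrow> (nat \<Rightarrow> nat) \<Rightarrow> config set" where
  "sector n L c = {\<xi> \<in> configs n L. \<forall>i. (\<Sum>x=1..L. \<xi> i x) = c i}"

lemma finite_sector: "finite (sector n L c)"
proof -
  \<comment> \<open>A common bound for all occupation numbers, which embeds the sector into a finite
    function space.\<close>
  define m where "m = (\<Sum>i<n. c i)"
  define A where "A = {v :: nat \<Rightarrow> nat. \<forall>x. (x \<in> {1..L} \<longrightarrow> v x \<in> {..m}) \<and> (x \<notin> {1..L} \<longrightarrow> v x = 0)}"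
  define B where "B = {\<xi>. \<forall>i. (i \<in> {..<n} \<longrightarrow> \<xi> i \<in> A) \<and> (i \<notin> {..<n} \<longrightarrow> \<xi> i = (\<lambda>x. 0))}"
  have "finite A"
    unfolding A_def by (rule finite_set_of_finite_funs) auto
  then have "finite B"
    unfolding B_def by (intro finite_set_of_finite_funs) auto
  moreover have "sector n L c \<subseteq> B"
  proof
    fix \<xi> assume \<xi>: "\<xi> \<in> sector n L c"
    have bound: "\<xi> i x \<le> m" if "i < n" "1 \<le> x" "x \<le> L" for i x
    proof -
      have "\<xi> i x \<le> (\<Sum>x=1..L. \<xi> i x)"
        using that by (intro member_le_sum) auto
      also have "\<dots> = c i" using \<xi> by (simp add: sector_def)
      also have "\<dots> \<le> m"
        unfolding m_def using that by (intro member_le_sum) auto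
      finally show ?thesis .
    qed
    from \<xi> have zero: "\<xi> i x = 0" if "\<not> (i < n \<and> 1 \<le> x \<and> x \<le> L)" for i x
      using that by (simp add: sector_def configs_def)
    show "\<xi> \<in> B"
      unfolding B_def A_def using bound zero by auto
  qed
  ultimately show ?thesis by (rule rev_finite_subset)
qed

lemma move_in_sector:
  assumes \<xi>: "\<xi> \<in> sector n L c" and k: "k < n" and xy: "x \<in> {1..L}" "y \<in> {1..L}" "x \<noteq> y"
    and pos: "\<xi> k x > 0"
  shows "move \<xi> k x y \<in> sector n L c"
proof -
  have "sum (shift (\<xi> k) x y) {1..L} = sum (\<xi> k) {1..L}"
    using sum_shift[of "{1..L}" "\<xi> k" x y] pos xy by simp
  moreover have "move \<xi> k x y \<in> configs n L"
    using \<xi> k xy by (auto simp: sector_def configs_def move_def)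
  ultimately show ?thesis
    using \<xi> by (auto simp: sector_def move_eq_shift)
qed

lemma jump_rate_eq_0: "\<xi> k x = 0 \<Longrightarrow> jump_rate q \<xi> k x = 0"
  by (simp add: jump_rate_def)

text \<open>Passes from matrix entries to the generator acting on \<open>f\<close>. Targets need to
  lie in \<open>C\<close> only for nonzero rates, because a jump of an absent particle may leave the
  sector.\<close>

lemma sum_jump_generator:
  fixes r :: "'i \<Rightarrow> real"
  assumes C: "finite C" "\<xi> \<in> C" and I: "\<And>i. i \<in> I \<Longrightarrow> r i \<noteq> 0 \<Longrightarrow> m i \<in> C"
  shows "(\<Sum>\<zeta>\<in>C. (\<Sum>i\<in>I. r i * (of_bool (\<zeta> = m i) - of_bool (\<zeta> = \<xi>))) * f \<zeta>)
    = (\<Sum>i\<in>I. r i * (f (m i) - f \<xi>))"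
proof -
  have point: "(\<Sum>\<zeta>\<in>C. of_bool (\<zeta> = z) * f \<zeta>) = f z" if "z \<in> C" for z
    using that C(1) by (simp add: of_bool_def if_distrib[where f = "\<lambda>t. t * _"] cong: if_cong)
  have "(\<Sum>\<zeta>\<in>C. (\<Sum>i\<in>I. r i * (of_bool (\<zeta> = m i) - of_bool (\<zeta> = \<xi>))) * f \<zeta>)
      = (\<Sum>i\<in>I. \<Sum>\<zeta>\<in>C. r i * (of_bool (\<zeta> = m i) - of_bool (\<zeta> = \<xi>)) * f \<zeta>)"
    unfolding sum_distrib_right by (rule sum.swap)
  also have "\<dots> = (\<Sum>i\<in>I. r i * ((\<Sum>\<zeta>\<in>C. of_bool (\<zeta> = m i) * f \<zeta>) - (\<Sum>\<zeta>\<in>C. of_bool (\<zeta> = \<xi>) * f \<zeta>)))"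
    by (simp only: sum_distrib_left sum_subtractf[symmetric] left_diff_distrib mult.assoc)
  also have "\<dots> = (\<Sum>i\<in>I. r i * (f (m i) - f \<xi>))"
  proof (rule sum.cong[OF refl])
    fix i assume i: "i \<in> I"
    show "r i * ((\<Sum>\<zeta>\<in>C. of_bool (\<zeta> = m i) * f \<zeta>) - (\<Sum>\<zeta>\<in>C. of_bool (\<zeta> = \<xi>) * f \<zeta>))
        = r i * (f (m i) - f \<xi>)"
      using I[OF i] point C(2) by (cases "r i = 0") auto
  qed
  finally show ?thesis .
qed

lemma tazrp_right_apply:
  assumes \<xi>: "\<xi> \<in> sector n L c"
  shows "(\<Sum>\<zeta>\<in>sector n L c. tazrp_right q n L \<xi> \<zeta> * f \<zeta>)
    = (\<Sum>x\<in>{1..<L}. \<Sum>k<n. jump_rate q \<xi> k x * (f (move \<xi> k x (x + 1)) - f \<xi>))"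
  unfolding tazrp_right_def sum.cartesian_product split_def
proof (rule sum_jump_generator[OF finite_sector \<xi>])
  fix i assume "i \<in> {1..<L} \<times> {..<n}" "jump_rate q \<xi> (snd i) (fst i) \<noteq> 0"
  then show "move \<xi> (snd i) (fst i) (fst i + 1) \<in> sector n L c"
    using jump_rate_eq_0[of \<xi>] by (intro move_in_sector[OF \<xi>]) auto
qed

lemma tazrp_left_apply:
  assumes \<eta>: "\<eta> \<in> sector n L c"
  shows "(\<Sum>\<zeta>\<in>sector n L c. tazrp_left q n L \<eta> \<zeta> * f \<zeta>)
    = (\<Sum>x\<in>{1..<L}. \<Sum>k<n. jump_rate q \<eta> k (x + 1) * (f (move \<eta> k (x + 1) x) - f \<eta>))"
proof -
  have "(\<Sum>\<zeta>\<in>sector n L c. tazrp_left q n L \<eta> \<zeta> * f \<zeta>)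
      = (\<Sum>x\<in>{2..L}. \<Sum>k<n. jump_rate q \<eta> k x * (f (move \<eta> k x (x - 1)) - f \<eta>))"
    unfolding tazrp_left_def sum.cartesian_product split_def
  proof (rule sum_jump_generator[OF finite_sector \<eta>])
    fix i assume "i \<in> {2..L} \<times> {..<n}" "jump_rate q \<eta> (snd i) (fst i) \<noteq> 0"
    then show "move \<eta> (snd i) (fst i) (fst i - 1) \<in> sector n L c"
      using jump_rate_eq_0[of \<eta>] by (intro move_in_sector[OF \<eta>]) auto
  qed
  \<comment> \<open>Left jumps are reindexed by the left end of their bond, to match the right jumps
    term by term.\<close>
  also have "\<dots> = (\<Sum>x\<in>{1..<L}. \<Sum>k<n. jump_rate q \<eta> k (x + 1) * (f (move \<eta> k (x + 1) x) - f \<eta>))"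
    by (rule sum.reindex_bij_witness[of _ "\<lambda>x. x + 1" "\<lambda>x. x - 1"]) auto
  finally show ?thesis .
qed

lemma generator_duality:
  assumes q: "0 < q" "q < 1" and \<xi>: "\<xi> \<in> sector n L c" and \<eta>: "\<eta> \<in> sector n L c'"
  shows "(\<Sum>\<zeta>\<in>sector n L c. tazrp_right q n L \<xi> \<zeta> * D_phi q n L \<zeta> \<eta>)
    = (\<Sum>\<zeta>\<in>sector n L c'. tazrp_left q n L \<eta> \<zeta> * D_phi q n L \<xi> \<zeta>)"
  unfolding D_phi_eq_D_poch[OF q] tazrp_right_apply[OF \<xi>] tazrp_left_apply[OF \<eta>]
  by (rule sum.cong[OF refl], rule bond_duality[OF q]) auto

section \<open>Duality for the Markov chains\<close>

theorem theorem3p2: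
  fixes q :: real and n L :: nat
  assumes "0 < q" and "q < 1" and "n \<ge> 1" and "L \<ge> 1"
  shows "\<forall>\<xi> \<in> configs n L. \<forall>\<eta> \<in> configs n L.
           D_phi q n L \<xi> \<eta> = D_poch q n L \<xi> \<eta> \<and>
           (\<forall>(M :: 'v measure) X (N :: 'w measure) Y.
              markov_chain (configs n L) (tazrp_right q n L) \<xi> M X \<and>
              markov_chain (configs n L) (tazrp_left q n L) \<eta> N Y \<longrightarrow>
              (\<forall>t\<ge>0.
                 integrable M (\<lambda>\<omega>. D_phi q n L (X t \<omega>) \<eta>) \<and>
                 integrable N (\<lambda>\<omega>. D_phi q n L \<xi> (Y t \<omega>)) \<and>
                 prob_space.expectation M (\<lambda>\<omega>. D_phi q n L (X t \<omega>) \<eta>) =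
                 prob_space.expectation N (\<lambda>\<omega>. D_phi q n L \<xi> (Y t \<omega>))))"
proof (intro ballI conjI[OF D_phi_eq_D_poch[OF assms(1,2)]] allI impI)
  fix \<xi> \<eta> and M :: "'v measure" and X and N :: "'w measure" and Y and t :: real
  assume \<xi>: "\<xi> \<in> configs n L" and \<eta>: "\<eta> \<in> configs n L" and t: "t \<ge> 0"
    and "markov_chain (configs n L) (tazrp_right q n L) \<xi> M X \<and>
         markov_chain (configs n L) (tazrp_left q n L) \<eta> N Y"
  then have X: "markov_chain (configs n L) (tazrp_right q n L) \<xi> M X"
    and Y: "markov_chain (configs n L) (tazrp_left q n L) \<eta> N Y" by auto
  interpret M: prob_space M using X by (simp add: markov_chain_def)
  interpret N: prob_space N using Y by (simp add: markov_chain_def)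
  define C where "C = sector n L (\<lambda>i. \<Sum>x=1..L. \<xi> i x)"
  define C' where "C' = sector n L (\<lambda>i. \<Sum>x=1..L. \<eta> i x)"
  have C: "finite C" "C \<subseteq> configs n L" "\<xi> \<in> C" and C': "finite C'" "C' \<subseteq> configs n L" "\<eta> \<in> C'"
    using \<xi> \<eta> by (auto simp: C_def C'_def finite_sector) (auto simp: sector_def)
  \<comment> \<open>The generator annihilates the constant function 1, and its jumps do not leave
    the sector.\<close>
  have rows: "(\<Sum>\<zeta>\<in>C. tazrp_right q n L \<xi>' \<zeta>) = 0" if "\<xi>' \<in> C" for \<xi>'
    using tazrp_right_apply[OF that[unfolded C_def], of q "\<lambda>_. 1"] by (simp add: C_def)
  have rows': "(\<Sum>\<zeta>\<in>C'. tazrp_left q n L \<eta>' \<zeta>) = 0" if "\<eta>' \<in> C'" for \<eta>'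
    using tazrp_left_apply[OF that[unfolded C'_def], of q "\<lambda>_. 1"] by (simp add: C'_def)
  obtain P where P: "transition_function (configs n L) (tazrp_right q n L) P"
    "\<And>t y. 0 \<le> t \<Longrightarrow> y \<in> configs n L \<Longrightarrow> measure M {\<omega> \<in> space M. X t \<omega> = y} = pmf (P t \<xi>) y"
    using markov_chain_law[OF X \<xi>] by blast
  obtain R where R: "transition_function (configs n L) (tazrp_left q n L) R"
    "\<And>t y. 0 \<le> t \<Longrightarrow> y \<in> configs n L \<Longrightarrow> measure N {\<omega> \<in> space N. Y t \<omega> = y} = pmf (R t \<eta>) y"
    using markov_chain_law[OF Y \<eta>] by blast
  have suppP: "set_pmf (P t \<xi>) \<subseteq> C"
    using transition_function_closed[OF P(1) C(1,2) rows t C(3)] .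
  have suppR: "set_pmf (R t \<eta>) \<subseteq> C'"
    using transition_function_closed[OF R(1) C'(1,2) rows' t C'(3)] .
  have "X t \<in> M \<rightarrow>\<^sub>M count_space (configs n L)" "Y t \<in> N \<rightarrow>\<^sub>M count_space (configs n L)"
    using X Y t by (auto simp: markov_chain_def)
  note lawX = M.expectation_eq_pmf_expectation[OF this(1) C(1,2) suppP]
    and lawY = N.expectation_eq_pmf_expectation[OF this(2) C'(1,2) suppR]
  have lX: "measure M {\<omega> \<in> space M. X t \<omega> = y} = pmf (P t \<xi>) y" if "y \<in> C" for y
    using P(2)[OF t] C(2) that by blast
  have lY: "measure N {\<omega> \<in> space N. Y t \<omega> = y} = pmf (R t \<eta>) y" if "y \<in> C'" for y
    using R(2)[OF t] C'(2) that by blast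
  have intM: "integrable M (\<lambda>\<omega>. D_phi q n L (X t \<omega>) \<eta>)"
    using lX by (rule lawX(1))
  have intN: "integrable N (\<lambda>\<omega>. D_phi q n L \<xi> (Y t \<omega>))"
    using lY by (rule lawY(1))
  have "M.expectation (\<lambda>\<omega>. D_phi q n L (X t \<omega>) \<eta>)
      = measure_pmf.expectation (P t \<xi>) (\<lambda>\<zeta>. D_phi q n L \<zeta> \<eta>)"
    using lX by (rule lawX(2))
  also have "\<dots> = measure_pmf.expectation (R t \<eta>) (D_phi q n L \<xi>)"
  proof (rule generator_duality_imp_semigroup_duality[OF P(1) R(1) C(1,2) rows C'(1,2) rows' _ t C(3) C'(3)])
    fix \<xi>' \<eta>' assume "\<xi>' \<in> C" "\<eta>' \<in> C'"
    then show "(\<Sum>\<zeta>\<in>C. tazrp_right q n L \<xi>' \<zeta> * D_phi q n L \<zeta> \<eta>')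
        = (\<Sum>\<zeta>\<in>C'. tazrp_left q n L \<eta>' \<zeta> * D_phi q n L \<xi>' \<zeta>)"
      unfolding C_def C'_def by (rule generator_duality[OF assms(1,2)])
  qed
  also have "\<dots> = N.expectation (\<lambda>\<omega>. D_phi q n L \<xi> (Y t \<omega>))"
    using lawY(2)[OF lY] by simp
  finally show "integrable M (\<lambda>\<omega>. D_phi q n L (X t \<omega>) \<eta>) \<and>
    integrable N (\<lambda>\<omega>. D_phi q n L \<xi> (Y t \<omega>)) \<and>
    M.expectation (\<lambda>\<omega>. D_phi q n L (X t \<omega>) \<eta>) = N.expectation (\<lambda>\<omega>. D_phi q n L \<xi> (Y t \<omega>))"
    using intM intN by blast
qed

end
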